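(* Let $(Q_1, * )$ and $(Q_2, \circ)$ be two quandles and let $\sigma: Q_1 \to \mathrm{Conj}_{-1}(\mathrm{Aut}(Q_2))$ and $\tau: Q_2 \to \mathrm{Conj}_{-1}(\mathrm{Aut}(Q_1))$ be two quandle homomorphisms. Then the set $Q=Q_1 \sqcup Q_2$ with the operation $$ x\star y=\begin{cases} x*y,& x, y \in Q_1, \\ x\circ y, &x, y \in Q_2, \\ \tau(y)(x), &x \in Q_1,\ y \in Q_2, \\ \sigma(y)(x), &x \in Q_2,\ y \in Q_1, \end{cases} $$ is a quandle if and only if the following conditions hold: (1) $\tau(z)(x)* y=\tau(\sigma(y)(z))(x* y)$ for all $x, y \in Q_1$ and $z \in Q_2$; (2) $\sigma(z)(x)\circ y=\sigma(\tau(y)(z))(x\circ y)$ for all $x, y \in Q_2$ and $z \in Q_1$.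
   Context: A quandle is a set $Q$ with a binary operation $*$ such that (1) $x*x=x$ for all $x\in Q$; (2) for every $x\in Q$ the map $y\mapsto y*x$ is a bijection of $Q$; (3) $(x*y)*z=(x*z)*(y*z)$ for all $x,y,z\in Q$. $\mathrm{Aut}(Q)$ is the group (under composition $(\varphi\psi)(x)=\varphi(\psi(x))$) of bijections of $Q$ preserving $*$. A quandle homomorphism is a map preserving the quandle operations. For a group $G$, $\mathrm{Conj}_{-1}(G)$ is the quandle on the set $G$ with operation $x*y=yxy^{-1}$. *)

theory Defs
  imports "HOL-Algebra.Bij"
begin

record 'a quandle_struct = "'a partial_object" +
  qop :: "'a \<Rightarrow> 'a \<Rightarrow> 'a" (infixl "\<star>\<index>" 70)

locale quandle =
  fixes Q :: "('a, 'm) quandle_struct_scheme" (structure)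
  assumes qop_closed: "\<lbrakk>x \<in> carrier Q; y \<in> carrier Q\<rbrakk> \<Longrightarrow> x \<star> y \<in> carrier Q"
    and qop_idem: "x \<in> carrier Q \<Longrightarrow> x \<star> x = x"
    and qop_bij: "x \<in> carrier Q \<Longrightarrow> bij_betw (\<lambda>y. y \<star> x) (carrier Q) (carrier Q)"
    and qop_distrib: "\<lbrakk>x \<in> carrier Q; y \<in> carrier Q; z \<in> carrier Q\<rbrakk>
      \<Longrightarrow> (x \<star> y) \<star> z = (x \<star> z) \<star> (y \<star> z)"

definition quandle_hom ::
    "('a, 'm) quandle_struct_scheme \<Rightarrow> ('b, 'n) quandle_struct_scheme \<Rightarrow> ('a \<Rightarrow> 'b) set" where
  "quandle_hom Q R = {f \<in> carrier Q \<rightarrow> carrier R.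
     \<forall>x \<in> carrier Q. \<forall>y \<in> carrier Q. f (x \<star>\<^bsub>Q\<^esub> y) = f x \<star>\<^bsub>R\<^esub> f y}"

text \<open>As everywhere in \<^theory>\<open>HOL-Algebra.Bij\<close>, a bijection of a carrier is represented by the
  function extended by \<^const>\<open>undefined\<close> outside the carrier, so that each bijection has exactly
  one representative; the product in \<^const>\<open>BijGroup\<close> is composition, right factor applied first.\<close>

definition quandle_Aut :: "('a, 'm) quandle_struct_scheme \<Rightarrow> ('a \<Rightarrow> 'a) monoid" where
  "quandle_Aut Q = BijGroup (carrier Q) \<lparr>carrier := quandle_hom Q Q \<inter> Bij (carrier Q)\<rparr>"

definition Conj_minus1 :: "('a, 'm) monoid_scheme \<Rightarrow> 'a quandle_struct" where
  "Conj_minus1 G = \<lparr>carrier = carrier G, qop = (\<lambda>x y. y \<otimes>\<^bsub>G\<^esub> x \<otimes>\<^bsub>G\<^esub> inv\<^bsub>G\<^esub> y)\<rparr>"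

fun glue_op ::
    "('a, 'm) quandle_struct_scheme \<Rightarrow> ('b, 'n) quandle_struct_scheme
      \<Rightarrow> ('a \<Rightarrow> 'b \<Rightarrow> 'b) \<Rightarrow> ('b \<Rightarrow> 'a \<Rightarrow> 'a) \<Rightarrow> 'a + 'b \<Rightarrow> 'a + 'b \<Rightarrow> 'a + 'b" where
  "glue_op Q1 Q2 \<sigma> \<tau> (Inl x) (Inl y) = Inl (x \<star>\<^bsub>Q1\<^esub> y)"
| "glue_op Q1 Q2 \<sigma> \<tau> (Inr x) (Inr y) = Inr (x \<star>\<^bsub>Q2\<^esub> y)"
| "glue_op Q1 Q2 \<sigma> \<tau> (Inl x) (Inr y) = Inl (\<tau> y x)"
| "glue_op Q1 Q2 \<sigma> \<tau> (Inr x) (Inl y) = Inr (\<sigma> y x)"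

definition glue ::
    "('a, 'm) quandle_struct_scheme \<Rightarrow> ('b, 'n) quandle_struct_scheme
      \<Rightarrow> ('a \<Rightarrow> 'b \<Rightarrow> 'b) \<Rightarrow> ('b \<Rightarrow> 'a \<Rightarrow> 'a) \<Rightarrow> ('a + 'b) quandle_struct" where
  "glue Q1 Q2 \<sigma> \<tau> = \<lparr>carrier = carrier Q1 <+> carrier Q2, qop = glue_op Q1 Q2 \<sigma> \<tau>\<rparr>"

lemma (in quandle) group_quandle_Aut: "group (quandle_Aut Q)"
proof -
  interpret B: group "BijGroup (carrier Q)" by (rule group_BijGroup)
  let ?A = "quandle_hom Q Q \<inter> Bij (carrier Q)"
  have "subgroup ?A (BijGroup (carrier Q))"
  proof (rule B.subgroupI)
    show "?A \<subseteq> carrier (BijGroup (carrier Q))" by (auto simp: BijGroup_def)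
    have "(\<lambda>x\<in>carrier Q. x) \<in> ?A"
      using id_Bij by (auto simp: quandle_hom_def qop_closed)
    then show "?A \<noteq> {}" by blast
  next
    fix f assume f: "f \<in> ?A"
    then have fB: "f \<in> Bij (carrier Q)"
      and bij: "bij_betw f (carrier Q) (carrier Q)"
      and hom: "\<And>x y. \<lbrakk>x \<in> carrier Q; y \<in> carrier Q\<rbrakk> \<Longrightarrow> f (x \<star> y) = f x \<star> f y"
      by (auto simp: Bij_def quandle_hom_def)
    let ?g = "inv_into (carrier Q) f"
    have g: "?g x \<in> carrier Q" "f (?g x) = x" if "x \<in> carrier Q" for x
      using that bij by (auto simp: bij_betw_def inv_into_into f_inv_into_f)
    have "?g (x \<star> y) = ?g x \<star> ?g y" if "x \<in> carrier Q" "y \<in> carrier Q" for x y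
    proof -
      have "?g (f (?g x \<star> ?g y)) = ?g x \<star> ?g y"
        using bij that g by (intro inv_into_f_f) (auto simp: bij_betw_def qop_closed)
      then show ?thesis using that g hom by simp
    qed
    then show "inv\<^bsub>BijGroup (carrier Q)\<^esub> f \<in> ?A"
      using fB g by (auto simp: inv_BijGroup quandle_hom_def qop_closed restrict_inv_into_Bij)
  next
    fix f g assume "f \<in> ?A" "g \<in> ?A"
    then show "f \<otimes>\<^bsub>BijGroup (carrier Q)\<^esub> g \<in> ?A"
      by (auto simp: BijGroup_def quandle_hom_def compose_Bij compose_eq qop_closed
          Pi_iff)
  qed
  then show ?thesis
    unfolding quandle_Aut_def by (rule B.subgroup_imp_group)
qed

lemma (in group) quandle_Conj_minus1: "quandle (Conj_minus1 G)"
proof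
  fix x assume "x \<in> carrier (Conj_minus1 G)"
  then have x: "x \<in> carrier G" by (simp add: Conj_minus1_def)
  then show "x \<star>\<^bsub>Conj_minus1 G\<^esub> x = x" by (simp add: Conj_minus1_def m_assoc)
  have "inv x \<otimes> (x \<otimes> w) = w" "x \<otimes> (inv x \<otimes> w) = w" if "w \<in> carrier G" for w
    using that x by (simp_all add: m_assoc[symmetric])
  then have "bij_betw (\<lambda>y. x \<otimes> y \<otimes> inv x) (carrier G) (carrier G)"
    using x by (intro bij_betw_byWitness[where f' = "\<lambda>y. inv x \<otimes> y \<otimes> x"])
      (auto simp: m_assoc)
  then show "bij_betw (\<lambda>y. y \<star>\<^bsub>Conj_minus1 G\<^esub> x)
      (carrier (Conj_minus1 G)) (carrier (Conj_minus1 G))"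
    by (simp add: Conj_minus1_def)
next
  fix x y z
  assume "x \<in> carrier (Conj_minus1 G)" "y \<in> carrier (Conj_minus1 G)"
    "z \<in> carrier (Conj_minus1 G)"
  then have xyz: "x \<in> carrier G" "y \<in> carrier G" "z \<in> carrier G"
    by (simp_all add: Conj_minus1_def)
  have "inv z \<otimes> (z \<otimes> w) = w" if "w \<in> carrier G" for w
    using that xyz by (simp add: m_assoc[symmetric])
  then show "(x \<star>\<^bsub>Conj_minus1 G\<^esub> y) \<star>\<^bsub>Conj_minus1 G\<^esub> z =
      (x \<star>\<^bsub>Conj_minus1 G\<^esub> z) \<star>\<^bsub>Conj_minus1 G\<^esub> (y \<star>\<^bsub>Conj_minus1 G\<^esub> z)"
    using xyz by (simp add: Conj_minus1_def m_assoc inv_mult_group)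
qed (simp add: Conj_minus1_def)

end

theory Submission
  imports Defs
begin

text \<open>Self-distributivity \<open>(x \<star> y) \<star> z = (x \<star> z) \<star> (y \<star> z)\<close> splits according to the summands of
  \<open>x, y, z\<close>. If all three agree it holds in that summand; if exactly \<open>x, y\<close> agree it says that
  \<open>\<sigma>\<close>, \<open>\<tau>\<close> take values in endomorphisms; if exactly \<open>y, z\<close> agree it says that \<open>\<sigma>\<close>, \<open>\<tau>\<close> turn the
  quandle operation into conjugation. The cases where exactly \<open>x, z\<close> agree are conditions (1) and (2).\<close>

lemma quandle_Aut_mult:
  assumes "f \<in> carrier (quandle_Aut Q)" "g \<in> carrier (quandle_Aut Q)" "x \<in> carrier Q"
  shows "(f \<otimes>\<^bsub>quandle_Aut Q\<^esub> g) x = f (g x)"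
  using assms by (simp add: quandle_Aut_def BijGroup_def compose_eq)

text \<open>The last part holds because \<open>f\<close> turns the quandle product into the
  conjugate of \<open>f y\<close> by \<open>f z\<close>: composing on the right with
  \<open>f z\<close> cancels the inverse, and the resulting equality of automorphisms is evaluated
  at \<open>u\<close>.\<close>

lemma quandle_hom_Conj_Aut:
  assumes "quandle R" and f: "f \<in> quandle_hom Q (Conj_minus1 (quandle_Aut R))"
    and y: "y \<in> carrier Q"
  shows quandle_hom_Conj_Aut_bij: "bij_betw (f y) (carrier R) (carrier R)"
    and quandle_hom_Conj_Aut_closed: "u \<in> carrier R \<Longrightarrow> f y u \<in> carrier R"
    and quandle_hom_Conj_Aut_op: "\<lbrakk>u \<in> carrier R; v \<in> carrier R\<rbrakk>
      \<Longrightarrow> f y (u \<star>\<^bsub>R\<^esub> v) = f y u \<star>\<^bsub>R\<^esub> f y v"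
    and quandle_hom_Conj_Aut_exchange: "\<lbrakk>z \<in> carrier Q; u \<in> carrier R\<rbrakk>
      \<Longrightarrow> f z (f y u) = f (y \<star>\<^bsub>Q\<^esub> z) (f z u)"
proof -
  let ?A = "quandle_Aut R"
  interpret A: group ?A using assms(1) by (rule quandle.group_quandle_Aut)
  have A: "f w \<in> carrier ?A" if "w \<in> carrier Q" for w
    using f that by (auto simp: quandle_hom_def Conj_minus1_def)
  show "bij_betw (f y) (carrier R) (carrier R)"
    and "u \<in> carrier R \<Longrightarrow> f y u \<in> carrier R"
    and "\<lbrakk>u \<in> carrier R; v \<in> carrier R\<rbrakk> \<Longrightarrow> f y (u \<star>\<^bsub>R\<^esub> v) = f y u \<star>\<^bsub>R\<^esub> f y v"
    using A[OF y] by (auto simp: quandle_Aut_def quandle_hom_def Bij_def)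
  assume z: "z \<in> carrier Q" and u: "u \<in> carrier R"
  have eq: "f (y \<star>\<^bsub>Q\<^esub> z) = f z \<otimes>\<^bsub>?A\<^esub> f y \<otimes>\<^bsub>?A\<^esub> inv\<^bsub>?A\<^esub> f z"
    using f y z by (simp add: quandle_hom_def Conj_minus1_def)
  \<comment> \<open>\<open>Q\<close> is an arbitrary structure here, so membership comes from the
    conjugation formula and not from closure of \<open>Q\<close>.\<close>
  then have yz: "f (y \<star>\<^bsub>Q\<^esub> z) \<in> carrier ?A"
    using A y z by simp
  have "f (y \<star>\<^bsub>Q\<^esub> z) \<otimes>\<^bsub>?A\<^esub> f z = f z \<otimes>\<^bsub>?A\<^esub> f y"
    unfolding eq using A y z by (simp add: A.m_assoc)
  then show "f z (f y u) = f (y \<star>\<^bsub>Q\<^esub> z) (f z u)"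
    using quandle_Aut_mult[OF yz A[OF z] u] quandle_Aut_mult[OF A[OF z] A[OF y] u] by simp
qed

text \<open>For the right translations of the glued structure, which map each summand to itself.
  With the injections inside the argument of \<open>f\<close>, the equations of
  \<open>glue_op\<close> simplify both hypotheses.\<close>

lemma bij_betw_Plus:
  assumes "bij_betw (\<lambda>a. f (Inl a)) A (Inl ` A)" and "bij_betw (\<lambda>b. f (Inr b)) B (Inr ` B)"
  shows "bij_betw f (A <+> B) (A <+> B)"
proof -
  have "bij_betw f (Inl ` A) (Inl ` A)" "bij_betw f (Inr ` B) (Inr ` B)"
    using assms by (auto simp: bij_betw_def inj_on_def image_image)
  then show ?thesis
    unfolding Plus_def by (rule bij_betw_combine) auto
qed

theorem proposition9p2:
  fixes Q1 :: "('a, 'm) quandle_struct_scheme" and Q2 :: "('b, 'n) quandle_struct_scheme"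
    and \<sigma> :: "'a \<Rightarrow> 'b \<Rightarrow> 'b" and \<tau> :: "'b \<Rightarrow> 'a \<Rightarrow> 'a"
  assumes "quandle Q1" and "quandle Q2"
    and "\<sigma> \<in> quandle_hom Q1 (Conj_minus1 (quandle_Aut Q2))"
    and "\<tau> \<in> quandle_hom Q2 (Conj_minus1 (quandle_Aut Q1))"
  shows "quandle (glue Q1 Q2 \<sigma> \<tau>) \<longleftrightarrow>
    (\<forall>x \<in> carrier Q1. \<forall>y \<in> carrier Q1. \<forall>z \<in> carrier Q2.
       \<tau> z x \<star>\<^bsub>Q1\<^esub> y = \<tau> (\<sigma> y z) (x \<star>\<^bsub>Q1\<^esub> y)) \<and>
    (\<forall>x \<in> carrier Q2. \<forall>y \<in> carrier Q2. \<forall>z \<in> carrier Q1.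
       \<sigma> z x \<star>\<^bsub>Q2\<^esub> y = \<sigma> (\<tau> y z) (x \<star>\<^bsub>Q2\<^esub> y))"
proof -
  interpret Q1: quandle Q1 by fact
  interpret Q2: quandle Q2 by fact
  let ?Q = "glue Q1 Q2 \<sigma> \<tau>"
  note \<sigma> = quandle_hom_Conj_Aut[OF assms(2,3)]
  note \<tau> = quandle_hom_Conj_Aut[OF assms(1,4)]
  have carrier: "carrier ?Q = carrier Q1 <+> carrier Q2" and op: "qop ?Q = glue_op Q1 Q2 \<sigma> \<tau>"
    by (simp_all add: glue_def)
  show ?thesis (is "_ \<longleftrightarrow> ?C1 \<and> ?C2")
  proof
    assume "quandle ?Q"
    then interpret Q: quandle ?Q .
    have ?C1
    proof (intro ballI)
      fix x y z assume "x \<in> carrier Q1" "y \<in> carrier Q1" "z \<in> carrier Q2"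
      then show "\<tau> z x \<star>\<^bsub>Q1\<^esub> y = \<tau> (\<sigma> y z) (x \<star>\<^bsub>Q1\<^esub> y)"
        \<comment> \<open>The element of the other summand goes in the middle: it acts on
          \<open>x\<close> by \<open>\<tau> z\<close> on the left side, and on the right side it has
          become \<open>\<sigma> y z\<close>, acting on the product of \<open>x\<close> and
          \<open>y\<close>.\<close>
        using Q.qop_distrib[of "Inl x" "Inr z" "Inl y"] by (simp add: carrier op InlI InrI)
    qed
    moreover have ?C2
    proof (intro ballI)
      fix x y z assume "x \<in> carrier Q2" "y \<in> carrier Q2" "z \<in> carrier Q1"
      then show "\<sigma> z x \<star>\<^bsub>Q2\<^esub> y = \<sigma> (\<tau> y z) (x \<star>\<^bsub>Q2\<^esub> y)"
        using Q.qop_distrib[of "Inr x" "Inl z" "Inr y"] by (simp add: carrier op InlI InrI)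
    qed
    ultimately show "?C1 \<and> ?C2" ..
  next
    assume C: "?C1 \<and> ?C2"
    have Inl: "bij_betw (\<lambda>a. Inl (g a)) A (Inl ` A)" if "bij_betw g A A" for g :: "'a \<Rightarrow> 'a" and A
      using that by (auto simp: bij_betw_def inj_on_def image_image[symmetric])
    have Inr: "bij_betw (\<lambda>a. Inr (g a)) A (Inr ` A)" if "bij_betw g A A" for g :: "'b \<Rightarrow> 'b" and A
      using that by (auto simp: bij_betw_def inj_on_def image_image[symmetric])
    show "quandle ?Q"
    proof
      fix x y assume "x \<in> carrier ?Q" "y \<in> carrier ?Q"
      then show "x \<star>\<^bsub>?Q\<^esub> y \<in> carrier ?Q"
        by (auto simp: carrier op Q1.qop_closed Q2.qop_closed \<sigma>(2) \<tau>(2))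
    next
      fix x assume "x \<in> carrier ?Q"
      then show "x \<star>\<^bsub>?Q\<^esub> x = x"
        by (auto simp: carrier op Q1.qop_idem Q2.qop_idem)
    next
      fix x assume "x \<in> carrier ?Q"
      then show "bij_betw (\<lambda>y. y \<star>\<^bsub>?Q\<^esub> x) (carrier ?Q) (carrier ?Q)"
        unfolding carrier op
        \<comment> \<open>Translation by \<open>Inl c\<close> is translation by \<open>c\<close> on
          \<open>Q1\<close> and the automorphism \<open>\<sigma> c\<close> on \<open>Q2\<close>;
          translation by \<open>Inr c\<close> is \<open>\<tau> c\<close> on \<open>Q1\<close> and
          translation by \<open>c\<close> on \<open>Q2\<close>.\<close>
        by (auto intro!: bij_betw_Plus Inl Inr Q1.qop_bij Q2.qop_bij \<sigma>(1) \<tau>(1))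
    next
      fix x y z assume "x \<in> carrier ?Q" "y \<in> carrier ?Q" "z \<in> carrier ?Q"
      then show "(x \<star>\<^bsub>?Q\<^esub> y) \<star>\<^bsub>?Q\<^esub> z = (x \<star>\<^bsub>?Q\<^esub> z) \<star>\<^bsub>?Q\<^esub> (y \<star>\<^bsub>?Q\<^esub> z)"
        unfolding carrier op using C
        \<comment> \<open>The exchange laws are reversed because their right-hand sides are again
          instances of their left-hand sides; reversed, they remove the product from the index of
          the outer map.\<close>
        by (elim PlusE) (simp_all add: Q1.qop_distrib Q2.qop_distrib \<sigma>(3) \<tau>(3)
            \<sigma>(4)[symmetric] \<tau>(4)[symmetric])
    qed
  qed
qed

end
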